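(* Let $G$ be a finite simple connected graph on $n$ vertices, and $L$ a positive integer such that the system $s\cdot\chi_C=1$ for every even cycle $C$ of $G$ of length $\le L$ is consistent over $\mathbb F_2$; let $W$ be the span of the vectors $\chi_C$ of these constraint cycles, $\mathcal F$ the family of switching classes of signings solving the system, and $\pi\colon W\to\mathbb F_2$ the linear form with $\pi(\chi_C)=1$ for every constraint cycle $C$. Then for every $k\ge1$, $$\min_{\sigma\in\mathcal F}\rho(A_\sigma)\le R_{\mathcal F}(k):=\Bigl(\sum_{z\in W}(-1)^{\pi(z)}N_{2k}(z)\Bigr)^{1/2k}.$$ By contrast, if $G$ is $d$-regular, the uniform average over all signings $\sigma\in\{\pm1\}^E$ satisfies $$\mathbb E_\sigma\operatorname{tr}(A_\sigma^{2k})=N_{2k}(0)\ge n\,t_{2k}(d),$$ where $t_{2k}(d)$ is the number of closed walks of length $2k$ at the root of the infinite $d$-regular tree. Hence $\bigl(\mathbb E_\sigma\operatorname{tr}(A_\sigma^{2k})\bigr)^{1/2k}$ is never below $(n\,t_{2k}(d))^{1/2k}$, whereas $R_{\mathcal F}(k)<(n\,t_{2k}(d))^{1/2k}$ holds if and only if $$\sum_{z\in W\setminus\{0\}}(-1)^{\pi(z)}N_{2k}(z)<-\bigl(N_{2k}(0)-n\,t_{2k}(d)\bigr).$$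
   Context: $G=(V,E)$. A signing is $\sigma\in\{\pm1\}^E$, encoded by $s\in\mathbb F_2^E$ with $\sigma_e=(-1)^{s_e}$; $A_\sigma$ is the signed adjacency matrix with $uv$ entry $\sigma_{uv}$ if $uv\in E$ and $0$ otherwise; $\rho(A_\sigma)=\max_i|\lambda_i(A_\sigma)|$. Switching at a vertex negates all edges at it and preserves the spectrum, so $\rho(A_\sigma)$ depends only on the switching class. For a cycle $C$, $\chi_C\in\mathbb F_2^E$ is the indicator vector of its edge set; even cycles are cycles of even length. When the system is consistent, $\pi(\sum_{C\in S}\chi_C)=|S|\bmod2$ is well defined on $W$. For a closed walk $w$ (with marked starting vertex and direction), its parity vector $z(w)\in\mathbb F_2^E$ has $z(w)_e$ equal to the number of traversals of $e$ modulo $2$. $N_\ell(z)$ is the number of closed walks of length $\ell$ in $G$ with parity vector $z$. *)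

theory Defs
  imports
    "Graph_Theory.Graph_Theory"
    "Jordan_Normal_Form.Spectral_Radius"
    "HOL-Library.Z2"
    "HOL-Library.Function_Algebras"
    "HOL-Library.FuncSet"
begin

text \<open>
  A finite simple graph is a \<^locale>\<open>pair_graph\<close>: a finite loop-free digraph whose arc relation
  is symmetric.  Each undirected edge \<open>{u, v}\<close> stands for the two arcs \<open>(u, v)\<close> and \<open>(v, u)\<close>.
\<close>

definition uedge :: "'a \<times> 'a \<Rightarrow> 'a set" where
  "uedge a = {fst a, snd a}"

definition edges :: "'a pair_pre_digraph \<Rightarrow> 'a set set" where
  "edges G = uedge ` parcs G"

definition regular :: "'a pair_pre_digraph \<Rightarrow> nat \<Rightarrow> bool" where
  "regular G d \<longleftrightarrow> (\<forall>v \<in> pverts G. out_degree (with_proj G) v = d)"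


section \<open>Vectors over the field with two elements\<close>

text \<open>
  Vectors indexed by the edges are functions into \<^typ>\<open>bit\<close> that vanish off the edge set,
  added pointwise.
\<close>

definition edge_vectors :: "'a pair_pre_digraph \<Rightarrow> ('a set \<Rightarrow> bit) set" where
  "edge_vectors G = {x. \<forall>e. e \<notin> edges G \<longrightarrow> x e = 0}"

definition vscale :: "bit \<Rightarrow> ('b \<Rightarrow> bit) \<Rightarrow> ('b \<Rightarrow> bit)" where
  "vscale c x = (\<lambda>e. c * x e)"

definition edge_dot :: "'a pair_pre_digraph \<Rightarrow> ('a set \<Rightarrow> bit) \<Rightarrow> ('a set \<Rightarrow> bit) \<Rightarrow> bit" where
  "edge_dot G x y = (\<Sum>e \<in> edges G. x e * y e)"

definition bit_sign :: "bit \<Rightarrow> real" where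
  "bit_sign b = (if b = 0 then 1 else - 1)"

interpretation bitvec: vector_space "vscale :: bit \<Rightarrow> ('b \<Rightarrow> bit) \<Rightarrow> ('b \<Rightarrow> bit)"
  by unfold_locales (auto simp: vscale_def fun_eq_iff algebra_simps)


section \<open>Constraint cycles\<close>

definition cycle_vector :: "('a \<times> 'a) list \<Rightarrow> 'a set \<Rightarrow> bit" where
  "cycle_vector p = (\<lambda>e. of_bool (e \<in> uedge ` set p))"

text \<open>
  The library predicate \<^const>\<open>pre_digraph.cycle\<close> also accepts the closed walk \<open>u, v, u\<close> of length
  two in a symmetric digraph, which is not a cycle of the undirected graph; hence the lower bound 3.
  A cycle is represented by any of its arc lists (each starting point and direction); all of these
  have the same \<^const>\<open>cycle_vector\<close>.
\<close>

definition constraint_cycles :: "'a pair_pre_digraph \<Rightarrow> nat \<Rightarrow> ('a \<times> 'a) list set" where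
  "constraint_cycles G L =
     {p. pre_digraph.cycle (with_proj G) p \<and> 3 \<le> length p \<and> even (length p) \<and> length p \<le> L}"

definition solutions :: "'a pair_pre_digraph \<Rightarrow> nat \<Rightarrow> ('a set \<Rightarrow> bit) set" where
  "solutions G L =
     {s \<in> edge_vectors G. \<forall>p \<in> constraint_cycles G L. edge_dot G s (cycle_vector p) = 1}"

definition consistent :: "'a pair_pre_digraph \<Rightarrow> nat \<Rightarrow> bool" where
  "consistent G L \<longleftrightarrow> solutions G L \<noteq> {}"

definition cycle_span :: "'a pair_pre_digraph \<Rightarrow> nat \<Rightarrow> ('a set \<Rightarrow> bit) set" where
  "cycle_span G L = bitvec.span (cycle_vector ` constraint_cycles G L)"

definition is_cycle_form :: "'a pair_pre_digraph \<Rightarrow> nat \<Rightarrow> (('a set \<Rightarrow> bit) \<Rightarrow> bit) \<Rightarrow> bool" where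
  "is_cycle_form G L \<pi> \<longleftrightarrow>
     (\<forall>x \<in> cycle_span G L. \<forall>y \<in> cycle_span G L. \<pi> (x + y) = \<pi> x + \<pi> y) \<and>
     (\<forall>c. \<forall>x \<in> cycle_span G L. \<pi> (vscale c x) = c * \<pi> x) \<and>
     (\<forall>p \<in> constraint_cycles G L. \<pi> (cycle_vector p) = 1)"

text \<open>For a consistent system such a form exists and is determined on the span.\<close>

lemma is_cycle_form_exists:
  assumes "consistent G L"
  shows "\<exists>\<pi>. is_cycle_form G L \<pi>"
proof -
  obtain s where s: "s \<in> solutions G L"
    using assms by (auto simp: consistent_def)
  have "edge_dot G s (x + y) = edge_dot G s x + edge_dot G s y" for x y
    unfolding edge_dot_def plus_fun_apply distrib_left sum.distrib ..
  moreover have "edge_dot G s (vscale c x) = c * edge_dot G s x" for c x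
    unfolding edge_dot_def vscale_def sum_distrib_left mult.left_commute[of c] ..
  moreover have "\<forall>p \<in> constraint_cycles G L. edge_dot G s (cycle_vector p) = 1"
    using s unfolding solutions_def by blast
  ultimately have "is_cycle_form G L (edge_dot G s)"
    unfolding is_cycle_form_def by blast
  then show ?thesis by blast
qed

lemma is_cycle_form_unique:
  assumes "is_cycle_form G L \<pi>" "is_cycle_form G L \<pi>'" "z \<in> cycle_span G L"
  shows "\<pi> z = \<pi>' z"
proof -
  let ?B = "cycle_vector ` constraint_cycles G L"
  have "z \<in> bitvec.span ?B"
    using assms(3) by (simp add: cycle_span_def)
  then have "z \<in> cycle_span G L \<and> \<pi> z = \<pi>' z"
  proof (induction rule: bitvec.span_induct_alt)
    case base
    have zero: "(0 :: 'a set \<Rightarrow> bit) \<in> cycle_span G L"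
      by (simp add: cycle_span_def bitvec.span_zero)
    have "\<phi> 0 = 0" if "is_cycle_form G L \<phi>" for \<phi>
    proof -
      have "\<phi> (vscale 0 0) = 0 * \<phi> 0"
        using that zero unfolding is_cycle_form_def by blast
      then show ?thesis by simp
    qed
    then show ?case using zero assms(1,2) by metis
  next
    case (step c x y)
    have x: "x \<in> cycle_span G L"
      using step(1) by (simp add: cycle_span_def bitvec.span_base)
    have cx: "vscale c x \<in> cycle_span G L"
      using x by (simp add: cycle_span_def bitvec.span_scale)
    have y: "y \<in> cycle_span G L" and eq: "\<pi> y = \<pi>' y"
      using step by auto
    have in_span: "vscale c x + y \<in> cycle_span G L"
      using cx y by (simp add: cycle_span_def bitvec.span_add)
    have "\<phi> (vscale c x + y) = c + \<phi> y" if "is_cycle_form G L \<phi>" for \<phi>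
      using that step(1) x cx y unfolding is_cycle_form_def by auto
    then show ?case using in_span eq assms(1,2) by metis
  qed
  then show ?thesis by simp
qed


section \<open>Signings and switching\<close>

definition signings :: "'a pair_pre_digraph \<Rightarrow> ('a set \<Rightarrow> real) set" where
  "signings G = edges G \<rightarrow>\<^sub>E {1, - 1}"

definition signing_of :: "'a pair_pre_digraph \<Rightarrow> ('a set \<Rightarrow> bit) \<Rightarrow> 'a set \<Rightarrow> real" where
  "signing_of G s = (\<lambda>e \<in> edges G. bit_sign (s e))"

definition switch_at :: "'a pair_pre_digraph \<Rightarrow> 'a \<Rightarrow> ('a set \<Rightarrow> real) \<Rightarrow> 'a set \<Rightarrow> real" where
  "switch_at G v \<sigma> = (\<lambda>e \<in> edges G. if v \<in> e then - \<sigma> e else \<sigma> e)"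

text \<open>
  Switching twice at a vertex is the identity on signings, so the reflexive transitive closure of
  single switches is an equivalence relation on signings.
\<close>

definition switching :: "'a pair_pre_digraph \<Rightarrow> ('a set \<Rightarrow> real) rel" where
  "switching G = {(\<sigma>, switch_at G v \<sigma>) | \<sigma> v. \<sigma> \<in> signings G \<and> v \<in> pverts G}\<^sup>*"

definition switching_family :: "'a pair_pre_digraph \<Rightarrow> nat \<Rightarrow> ('a set \<Rightarrow> real) set set" where
  "switching_family G L = (signing_of G ` solutions G L) // switching G"


section \<open>The signed adjacency matrix\<close>

text \<open>The list \<open>vs\<close> enumerates the vertices and thereby fixes the order of rows and columns.\<close>

definition signed_adj :: "'a pair_pre_digraph \<Rightarrow> 'a list \<Rightarrow> ('a set \<Rightarrow> real) \<Rightarrow> real mat" where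
  "signed_adj G vs \<sigma> = mat (length vs) (length vs)
     (\<lambda>(i, j). if (vs ! i, vs ! j) \<in> parcs G then \<sigma> {vs ! i, vs ! j} else 0)"

definition signed_radius :: "'a pair_pre_digraph \<Rightarrow> 'a list \<Rightarrow> ('a set \<Rightarrow> real) \<Rightarrow> real" where
  "signed_radius G vs \<sigma> = spectral_radius (map_mat complex_of_real (signed_adj G vs \<sigma>))"

definition mat_trace :: "'b::comm_monoid_add mat \<Rightarrow> 'b" where
  "mat_trace A = (\<Sum>i < dim_row A. A $$ (i, i))"

definition signing_average :: "'a pair_pre_digraph \<Rightarrow> (('a set \<Rightarrow> real) \<Rightarrow> real) \<Rightarrow> real" where
  "signing_average G f = (\<Sum>\<sigma> \<in> signings G. f \<sigma>) / real (card (signings G))"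


section \<open>Closed walks\<close>

text \<open>
  The starting vertex is recorded explicitly, since the empty arc list is a closed walk at every
  vertex.
\<close>

definition closed_walks :: "'a pair_pre_digraph \<Rightarrow> nat \<Rightarrow> ('a \<times> ('a \<times> 'a) list) set" where
  "closed_walks G l = {(u, p). pre_digraph.awalk (with_proj G) u p u \<and> length p = l}"

definition parity_vector :: "('a \<times> 'a) list \<Rightarrow> 'a set \<Rightarrow> bit" where
  "parity_vector p = (\<lambda>e. of_nat (count_list (map uedge p) e))"

definition walk_count :: "'a pair_pre_digraph \<Rightarrow> nat \<Rightarrow> ('a set \<Rightarrow> bit) \<Rightarrow> nat" where
  "walk_count G l z = card {(u, p) \<in> closed_walks G l. parity_vector p = z}"

definition family_bound ::
    "'a pair_pre_digraph \<Rightarrow> nat \<Rightarrow> (('a set \<Rightarrow> bit) \<Rightarrow> bit) \<Rightarrow> nat \<Rightarrow> real" where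
  "family_bound G L \<pi> k =
     root (2 * k) (\<Sum>z \<in> cycle_span G L. bit_sign (\<pi> z) * real (walk_count G (2 * k) z))"


section \<open>The regular tree\<close>

text \<open>
  The \<open>d\<close>-regular tree as the Cayley graph of the free product of \<open>d\<close> copies of the group of order
  two: vertices are the words over \<open>d\<close> letters without equal neighbouring letters, and two words are
  adjacent iff one arises from the other by prepending a letter.  The root is the empty word.  For
  \<open>d = 0\<close> and \<open>d = 1\<close> this is the (finite) tree with one and two vertices, respectively.
\<close>

definition tree_verts :: "nat \<Rightarrow> nat list set" where
  "tree_verts d = {w. set w \<subseteq> {..<d} \<and> distinct_adj w}"

definition regular_tree :: "nat \<Rightarrow> nat list pair_pre_digraph" where
  "regular_tree d = \<lparr>
     pverts = tree_verts d,
     parcs = {(x, y) \<in> tree_verts d \<times> tree_verts d. \<exists>a. y = a # x \<or> x = a # y} \<rparr>"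

definition tree_walk_count :: "nat \<Rightarrow> nat \<Rightarrow> nat" where
  "tree_walk_count d l =
     card {p. pre_digraph.awalk (with_proj (regular_tree d)) [] p [] \<and> length p = l}"

lemma regular_regular_tree: "regular (regular_tree d) d"
  unfolding regular_def
proof
  fix v assume v: "v \<in> pverts (regular_tree d)"
  then have vt: "v \<in> tree_verts d" by (simp add: regular_tree_def)
  have out: "out_arcs (with_proj (regular_tree d)) v =
      Pair v ` {y \<in> tree_verts d. \<exists>a. y = a # v \<or> v = a # y}"
    using vt by (auto simp: out_arcs_def regular_tree_def)
  have "card {y \<in> tree_verts d. \<exists>a. y = a # v \<or> v = a # y} = d"
  proof (cases v)
    case Nil
    have "{y \<in> tree_verts d. \<exists>a. y = a # v \<or> v = a # y} = (\<lambda>a. [a]) ` {..<d}"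
      using Nil by (auto simp: tree_verts_def)
    then show ?thesis by (simp add: card_image inj_on_def)
  next
    case (Cons b w)
    have b: "b < d" and w: "w \<in> tree_verts d"
      using vt Cons by (auto simp: tree_verts_def distinct_adj_Cons)
    have eq: "{y \<in> tree_verts d. \<exists>a. y = a # v \<or> v = a # y} =
        insert w ((\<lambda>a. a # v) ` ({..<d} - {b}))"
      using vt w Cons by (auto simp: tree_verts_def distinct_adj_Cons)
    have "w \<notin> (\<lambda>a. a # v) ` ({..<d} - {b})"
      using Cons by (auto dest: arg_cong[of _ _ length])
    then have "card (insert w ((\<lambda>a. a # v) ` ({..<d} - {b}))) =
        Suc (card ((\<lambda>a. a # v) ` ({..<d} - {b})))"
      by simp
    also have "\<dots> = d"
      using b by (subst card_image) (auto simp: inj_on_def)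
    finally show ?thesis by (simp add: eq)
  qed
  then show "out_degree (with_proj (regular_tree d)) v = d"
    by (simp add: out_degree_def out card_image inj_on_def)
qed

end

theory Submission
  imports Defs "HOL-Analysis.L2_Norm" "HOL-Library.Sublist"
begin

text \<open>
  The trace of \<open>A\<^sub>\<sigma>\<^sup>l\<close> is a sum over closed walks \<open>w\<close> of the signs \<open>(-1)\<^bsup>s \<cdot> z(w)\<^esup>\<close>.  The solutions of the
  system form a coset of the orthogonal complement of \<open>W\<close>, so averaging over them kills every walk with
  \<open>z(w) \<notin> W\<close>, because some vector of the complement pairs nontrivially with \<open>z(w)\<close>, and gives the others
  the sign \<open>(-1)\<^bsup>\<pi>(z(w))\<^esup>\<close>.  Some solution has a trace not above this average, and its spectral radius
  satisfies \<open>\<rho>\<^bsup>2k\<^esup> \<le> tr(A\<^sub>\<sigma>\<^bsup>2k\<^esup>)\<close>.  The average over all signings is the case \<open>W = 0\<close>.  A covering map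
  from the \<open>d\<close>-regular tree sends closed walks at the root injectively to closed walks of \<open>G\<close>, and these
  have parity vector \<open>0\<close> since a closed walk in a tree traverses every edge an even number of times.
\<close>

section \<open>Characters on edge vectors\<close>

lemma bit_sign_add: "bit_sign (a + b) = bit_sign a * bit_sign b"
  by (cases "a = 0"; cases "b = 0") (simp_all add: bit_sign_def)

lemma bit_vector_add_self: "x + x = (0 :: 'b \<Rightarrow> bit)"
  by (simp add: fun_eq_iff)

lemma edge_dot_add_left: "edge_dot G (x + y) z = edge_dot G x z + edge_dot G y z"
  by (simp add: edge_dot_def distrib_right sum.distrib del: add_bit_eq_xor mult_bit_eq_and)

lemma edge_dot_add_right: "edge_dot G x (y + z) = edge_dot G x y + edge_dot G x z"
  by (simp add: edge_dot_def distrib_left sum.distrib del: add_bit_eq_xor mult_bit_eq_and)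

lemma edge_dot_indicator:
  assumes "finite (edges G)" "e \<in> edges G"
  shows "edge_dot G (\<lambda>f. of_bool (f = e)) x = x e" "edge_dot G x (\<lambda>f. of_bool (f = e)) = x e"
proof -
  have "edge_dot G (\<lambda>f. of_bool (f = e)) x = (\<Sum>f\<in>edges G. if f = e then x f else 0)"
    "edge_dot G x (\<lambda>f. of_bool (f = e)) = (\<Sum>f\<in>edges G. if f = e then x f else 0)"
    unfolding edge_dot_def by (auto intro!: sum.cong)
  then show "edge_dot G (\<lambda>f. of_bool (f = e)) x = x e" 
     "edge_dot G x (\<lambda>f. of_bool (f = e)) = x e"
    using assms by simp_all
qed

lemma edge_vectors_add: "x \<in> edge_vectors G \<Longrightarrow> y \<in> edge_vectors G \<Longrightarrow> x + y \<in> edge_vectors G"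
  by (simp add: edge_vectors_def)

lemma finite_edge_vectors:
  assumes "finite (edges G)"
  shows "finite (edge_vectors G)"
proof -
  have "edge_vectors G \<subseteq> (\<lambda>A e. of_bool (e \<in> A)) ` Pow (edges G)"
  proof
    fix x assume x: "x \<in> edge_vectors G"
    have "x = (\<lambda>e. of_bool (e \<in> {e. x e = 1}))"
      by (auto simp: fun_eq_iff)
    moreover have "{e. x e = 1} \<in> Pow (edges G)"
      using x by (auto simp: edge_vectors_def)
    ultimately show "x \<in> (\<lambda>A e. of_bool (e \<in> A)) ` Pow (edges G)"
      by blast
  qed
  then show ?thesis
    by (rule finite_subset) (simp add: assms)
qed

lemma sum_fun_apply: "(\<Sum>i\<in>I. g i) x = (\<Sum>i\<in>I. g i x)"
  for g :: "'i \<Rightarrow> 'b \<Rightarrow> 'c::comm_monoid_add"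
  by (induction I rule: infinite_finite_induct) simp_all

lemma edge_vector_decomposition:
  assumes "finite (edges G)" "x \<in> edge_vectors G"
  shows "x = (\<Sum>e\<in>edges G. vscale (x e) (\<lambda>f. of_bool (f = e)))"
proof
  fix f
  have "(\<Sum>e\<in>edges G. vscale (x e) (\<lambda>f. of_bool (f = e))) f =
      (\<Sum>e\<in>edges G. if e = f then x e else 0)"
    unfolding vscale_def sum_fun_apply by (auto intro!: sum.cong)
  also have "\<dots> = x f"
    using assms by (auto simp: edge_vectors_def)
  finally show "x f = (\<Sum>e\<in>edges G. vscale (x e) (\<lambda>f. of_bool (f = e))) f" ..
qed

text \<open>Finite-dimensional duality: \<open>z\<close> is independent of a basis \<open>C\<close>
  of the span of \<open>B\<close>, so some linear functional vanishes on \<open>C\<close> and is 1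
  at \<open>z\<close>; in coordinates it is the pairing with a vector \<open>t\<close>.\<close>

lemma separating_edge_vector:
  assumes fin: "finite (edges G)" and B: "B \<subseteq> edge_vectors G"
    and z: "z \<in> edge_vectors G" "z \<notin> bitvec.span B"
  obtains t where "t \<in> edge_vectors G" "\<And>b. b \<in> B \<Longrightarrow> edge_dot G t b = 0" "edge_dot G t z = 1"
proof -
  \<comment> \<open>The target space is the field itself, so the linear maps of \<open>P\<close> are
    linear functionals.\<close>
  interpret P: vector_space_pair "vscale :: bit \<Rightarrow> ('a set \<Rightarrow> bit) \<Rightarrow> _" "(*) :: bit \<Rightarrow> bit \<Rightarrow> bit"
    by unfold_locales (simp_all add: algebra_simps del: add_bit_eq_xor mult_bit_eq_and)
  obtain C where C: "C \<subseteq> B" "bitvec.independent C" "bitvec.span B = bitvec.span C"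
    by (metis bitvec.basis_exists bitvec.span_eq bitvec.span_superset order.trans bitvec.span_mono bitvec.span_span order_antisym)
  have ind: "bitvec.independent (insert z C)"
    using z C by (simp add: bitvec.independent_insert)
  have zC: "z \<notin> C"
    using z C bitvec.span_base by blast
  define f where "f = P.construct (insert z C) (\<lambda>b. of_bool (b = z))"
  have lin: "Vector_Spaces.linear vscale (*) f"
    unfolding f_def by (rule P.linear_construct[OF ind])
  interpret f: Vector_Spaces.linear vscale "(*)" f by (rule lin)
  have fz: "f z = 1"
    unfolding f_def by (subst P.construct_basis[OF ind]) simp_all
  have fC: "f c = 0" if "c \<in> C" for c
    using that zC unfolding f_def by (subst P.construct_basis[OF ind]) auto
  have fB: "f b = 0" if "b \<in> B" for b
    using that C P.linear_eq_0_on_span[OF lin fC] bitvec.span_base by blast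
  \<comment> \<open>The coordinates of \<open>f\<close>: its values at the unit vectors of the
    edges, and 0 off the edge set.\<close>
  define t where "t = (\<lambda>e. if e \<in> edges G then f (\<lambda>f. of_bool (f = e)) else 0)"
  have dot: "edge_dot G t x = f x" if "x \<in> edge_vectors G" for x
  proof -
    have "f x = (\<Sum>e\<in>edges G. x e * f (\<lambda>f. of_bool (f = e)))"
      by (subst edge_vector_decomposition[OF fin that]) (simp only: f.sum f.scale)
    also have "\<dots> = edge_dot G t x"
      unfolding edge_dot_def t_def by (intro sum.cong) (auto simp: mult.commute)
    finally show ?thesis ..
  qed
  show thesis
  proof
    show "t \<in> edge_vectors G"
      by (simp add: t_def edge_vectors_def)
    show "edge_dot G t b = 0" if "b \<in> B" for b
      using that B fB dot by auto
    show "edge_dot G t z = 1"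
      using dot fz z by simp
  qed
qed

text \<open>Translation by \<open>t\<close> is an involution of \<open>S\<close>, as
  \<open>t + t = 0\<close>, and flips every sign; the sum therefore equals its own negative.\<close>

lemma sum_bit_sign_translation:
  assumes "\<And>s. s \<in> S \<Longrightarrow> s + t \<in> S" "edge_dot G t z = 1"
  shows "(\<Sum>s\<in>S. bit_sign (edge_dot G s z)) = 0"
proof -
  have "(\<Sum>s\<in>S. bit_sign (edge_dot G s z)) = (\<Sum>s\<in>S. bit_sign (edge_dot G (s + t) z))"
    by (rule sum.reindex_bij_witness[of _ "\<lambda>s. s + t" "\<lambda>s. s + t"])
      (auto simp: assms add.assoc bit_vector_add_self)
  also have "\<dots> = (\<Sum>s\<in>S. - bit_sign (edge_dot G s z))"
    unfolding edge_dot_add_left bit_sign_add assms(2) by (simp add: bit_sign_def)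
  finally show ?thesis
    by (simp add: sum_negf)
qed


section \<open>Traces as sums over closed walks\<close>

text \<open>Both endpoints are free, since these walks expand single entries of matrix powers. The
  empty list also joins a non-vertex to itself; \<open>closed_walks_eq\<close> therefore restricts
  \<open>u\<close> to \<open>pverts G\<close>.\<close>

definition arc_walks :: "'a pair_pre_digraph \<Rightarrow> nat \<Rightarrow> 'a \<Rightarrow> 'a \<Rightarrow> ('a \<times> 'a) list set" where
  "arc_walks G l u v = {p. set p \<subseteq> parcs G \<and> pcas u p v \<and> length p = l}"

lemma closed_walks_eq: "closed_walks G l = (SIGMA u : pverts G. arc_walks G l u u)"
  by (auto simp: closed_walks_def arc_walks_def pre_digraph.awalk_def cas_with_proj_eq)

lemma finite_arc_walks: "finite (parcs G) \<Longrightarrow> finite (arc_walks G l u v)"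
  by (rule finite_subset[OF _ finite_lists_length_eq[of _ l]]) (auto simp: arc_walks_def)

lemma pcas_snoc: "pcas u (p @ [a]) v \<longleftrightarrow> pcas u p (fst a) \<and> snd a = v"
  by (induction p arbitrary: u) auto

text \<open>The last arc is split off because the recursion for \<open>^\<^sub>m\<close> puts the
  new factor on the right.\<close>

lemma arc_walks_Suc:
  assumes "pair_wf_digraph G"
  shows "arc_walks G (Suc l) u v =
    (\<Union>x \<in> {x \<in> pverts G. (x, v) \<in> parcs G}. (\<lambda>p. p @ [(x, v)]) ` arc_walks G l u x)"
proof (intro Set.set_eqI iffI)
  fix p assume p: "p \<in> arc_walks G (Suc l) u v"
  then obtain q a where q: "p = q @ [a]"
    by (cases p rule: rev_cases) (auto simp: arc_walks_def)
  show "p \<in> (\<Union>x \<in> {x \<in> pverts G. (x, v) \<in> parcs G}. (\<lambda>p. p @ [(x, v)]) ` arc_walks G l u x)"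
    using p pair_wf_digraph.in_arcsD1[OF assms] unfolding q
    by (cases a) (auto simp: arc_walks_def pcas_snoc)
qed (auto simp: arc_walks_def pcas_snoc)

definition walk_sign :: "('a set \<Rightarrow> real) \<Rightarrow> ('a \<times> 'a) list \<Rightarrow> real" where
  "walk_sign \<sigma> p = prod_list (map (\<lambda>a. \<sigma> (uedge a)) p)"

lemma walk_sign_sum_Suc:
  assumes "pair_fin_digraph G"
  shows "(\<Sum>p\<in>arc_walks G (Suc l) u v. walk_sign \<sigma> p) =
    (\<Sum>x\<in>pverts G. (\<Sum>p\<in>arc_walks G l u x. walk_sign \<sigma> p) *
       (if (x, v) \<in> parcs G then \<sigma> {x, v} else 0))"
proof -
  interpret pair_fin_digraph G by fact
  have wf: "pair_wf_digraph G" by unfold_locales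
  have "(\<Sum>p\<in>arc_walks G (Suc l) u v. walk_sign \<sigma> p) =
    (\<Sum>x \<in> {x \<in> pverts G. (x, v) \<in> parcs G}. \<Sum>p\<in>(\<lambda>p. p @ [(x, v)]) ` arc_walks G l u x. walk_sign \<sigma> p)"
    \<comment> \<open>The last arc \<open>(x, v)\<close> of a walk reveals \<open>x\<close>, which
      makes the union disjoint.\<close>
    unfolding arc_walks_Suc[OF wf]
    by (rule sum.UNION_disjoint) (auto simp: pair_finite_verts finite_arc_walks pair_finite_arcs)
  also have "\<dots> = (\<Sum>x \<in> {x \<in> pverts G. (x, v) \<in> parcs G}.
      (\<Sum>p\<in>arc_walks G l u x. walk_sign \<sigma> p) * \<sigma> {x, v})"
    by (intro sum.cong)
      (auto simp: sum.reindex inj_on_def walk_sign_def uedge_def sum_distrib_right)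
  also have "\<dots> = (\<Sum>x\<in>pverts G. (\<Sum>p\<in>arc_walks G l u x. walk_sign \<sigma> p) *
       (if (x, v) \<in> parcs G then \<sigma> {x, v} else 0))"
    by (intro sum.mono_neutral_cong_left) (auto simp: pair_finite_verts)
  finally show ?thesis .
qed

lemma signed_adj_carrier: "signed_adj G vs \<sigma> \<in> carrier_mat (length vs) (length vs)"
  by (simp add: signed_adj_def)

lemma signed_adj_pow:
  assumes "pair_fin_digraph G" "distinct vs" "set vs = pverts G"
    and "i < length vs" "j < length vs"
  shows "(signed_adj G vs \<sigma> ^\<^sub>m l) $$ (i, j) = (\<Sum>p\<in>arc_walks G l (vs ! i) (vs ! j). walk_sign \<sigma> p)"
  using assms(5)
proof (induction l arbitrary: j)
  case 0
  \<comment> \<open>Distinctness of \<open>vs\<close> makes the empty walk join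
    \<open>vs ! i\<close> to \<open>vs ! j\<close> only for \<open>i = j\<close>, as in the identity
    matrix.\<close>
  have "arc_walks G 0 (vs ! i) (vs ! j) = (if i = j then {[]} else {})"
    using 0 assms by (auto simp: arc_walks_def nth_eq_iff_index_eq)
  then show ?case
    using 0 assms by (simp add: signed_adj_def walk_sign_def)
next
  case (Suc l)
  let ?A = "signed_adj G vs \<sigma>"
  have dim: "dim_row ?A = length vs" "dim_col ?A = length vs"
    by (simp_all add: signed_adj_def)
  have "(?A ^\<^sub>m Suc l) $$ (i, j) = (\<Sum>k<length vs. (?A ^\<^sub>m l) $$ (i, k) * ?A $$ (k, j))"
    using Suc.prems assms(4) by (simp add: dim scalar_prod_def atLeast0LessThan)
  also have "\<dots> = (\<Sum>k<length vs. (\<Sum>p\<in>arc_walks G l (vs ! i) (vs ! k). walk_sign \<sigma> p) *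
       (if (vs ! k, vs ! j) \<in> parcs G then \<sigma> {vs ! k, vs ! j} else 0))"
    using Suc.prems by (intro sum.cong) (simp_all add: Suc.IH, simp add: signed_adj_def)
  also have "\<dots> = (\<Sum>x\<in>pverts G. (\<Sum>p\<in>arc_walks G l (vs ! i) x. walk_sign \<sigma> p) *
       (if (x, vs ! j) \<in> parcs G then \<sigma> {x, vs ! j} else 0))"
    by (rule sum.reindex_bij_betw[OF bij_betw_nth]) (use assms in auto)
  finally show ?case
    by (simp add: walk_sign_sum_Suc[OF assms(1)])
qed

lemma trace_signed_adj_pow:
  assumes "pair_fin_digraph G" "distinct vs" "set vs = pverts G"
  shows "mat_trace (signed_adj G vs \<sigma> ^\<^sub>m l) = (\<Sum>(u, p)\<in>closed_walks G l. walk_sign \<sigma> p)"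
proof -
  interpret pair_fin_digraph G by fact
  have "mat_trace (signed_adj G vs \<sigma> ^\<^sub>m l) =
      (\<Sum>i<length vs. \<Sum>p\<in>arc_walks G l (vs ! i) (vs ! i). walk_sign \<sigma> p)"
    unfolding mat_trace_def
    by (intro sum.cong) (simp_all add: signed_adj_pow[OF assms], simp add: signed_adj_def)
  also have "\<dots> = (\<Sum>u\<in>pverts G. \<Sum>p\<in>arc_walks G l u u. walk_sign \<sigma> p)"
    by (rule sum.reindex_bij_betw[OF bij_betw_nth]) (use assms in auto)
  also have "\<dots> = (\<Sum>(u, p)\<in>closed_walks G l. walk_sign \<sigma> p)"
    unfolding closed_walks_eq
    by (rule sum.Sigma) (auto simp: pair_finite_verts finite_arc_walks pair_finite_arcs)
  finally show ?thesis .
qed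

section \<open>Parity vectors and character sums over sets of signings\<close>

lemma parity_vector_Nil [simp]: "parity_vector [] = 0"
  by (simp add: parity_vector_def fun_eq_iff)

lemma parity_vector_Cons: "parity_vector (a # p) = (\<lambda>e. of_bool (e = uedge a)) + parity_vector p"
  by (auto simp: parity_vector_def fun_eq_iff simp del: add_bit_eq_xor)

lemma parity_vector_in_edge_vectors:
  assumes "set p \<subseteq> parcs G"
  shows "parity_vector p \<in> edge_vectors G"
proof -
  have "count_list (map uedge p) e = 0" if "e \<notin> edges G" for e
    using that assms by (intro count_notin) (auto simp: edges_def)
  then show ?thesis
    by (simp add: edge_vectors_def parity_vector_def)
qed

text \<open>\<open>bit_sign\<close> turns sums into products, so the signs of an edge traversed an
  even number of times cancel and only the parity vector remains.\<close>

lemma walk_sign_signing_of: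
  assumes "finite (edges G)" "set p \<subseteq> parcs G"
  shows "walk_sign (signing_of G s) p = bit_sign (edge_dot G s (parity_vector p))"
  using assms(2)
proof (induction p)
  case Nil
  then show ?case by (simp add: walk_sign_def bit_sign_def edge_dot_def)
next
  case (Cons a p)
  have "uedge a \<in> edges G"
    using Cons.prems by (auto simp: edges_def)
  then have "walk_sign (signing_of G s) (a # p) = bit_sign (s (uedge a)) * walk_sign (signing_of G s) p"
    by (simp add: walk_sign_def signing_of_def)
  then show ?case
    unfolding parity_vector_Cons edge_dot_add_right bit_sign_add
      edge_dot_indicator(2)[OF assms(1) \<open>uedge a \<in> edges G\<close>]
    using Cons by simp
qed

text \<open>After exchanging the sums, each walk carries a character sum over \<open>S\<close>: on
  \<open>W\<close> all its terms equal the sign given by \<open>\<pi>\<close>, and off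
  \<open>W\<close> it vanishes because \<open>S\<close> is invariant under a translation that flips
  the sign. The general form serves both the solutions with \<open>cycle_span\<close> and all edge
  vectors with \<open>{0}\<close>.\<close>

lemma sum_trace_signing_of:
  assumes G: "pair_fin_digraph G" and vs: "distinct vs" "set vs = pverts G"
    and W: "finite W" "\<And>s z. s \<in> S \<Longrightarrow> z \<in> W \<Longrightarrow> edge_dot G s z = \<pi> z"
    and sep: "\<And>z. z \<in> edge_vectors G - W \<Longrightarrow> \<exists>t. (\<forall>s\<in>S. s + t \<in> S) \<and> edge_dot G t z = 1"
  shows "(\<Sum>s\<in>S. mat_trace (signed_adj G vs (signing_of G s) ^\<^sub>m l)) =
    real (card S) * (\<Sum>z\<in>W. bit_sign (\<pi> z) * real (walk_count G l z))"
proof -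
  interpret pair_fin_digraph G by fact
  have fin: "finite (edges G)"
    by (simp add: edges_def pair_finite_arcs)
  have finw: "finite (closed_walks G l)"
    unfolding closed_walks_eq by (auto simp: pair_finite_verts finite_arc_walks pair_finite_arcs)
  have arcs: "set p \<subseteq> parcs G" if "(u, p) \<in> closed_walks G l" for u p
    using that by (auto simp: closed_walks_eq arc_walks_def)
  then have parity: "parity_vector (snd w) \<in> edge_vectors G" if "w \<in> closed_walks G l" for w
    using that parity_vector_in_edge_vectors by (metis prod.collapse)
  define f where "f z = (\<Sum>s\<in>S. bit_sign (edge_dot G s z))" for z
  have f_in: "f z = real (card S) * bit_sign (\<pi> z)" if "z \<in> W" for z
    using that by (simp add: f_def W)
  have f_out: "f z = 0" if "z \<in> edge_vectors G - W" for z
    using sep[OF that] sum_bit_sign_translation unfolding f_def by blast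
  have "(\<Sum>s\<in>S. mat_trace (signed_adj G vs (signing_of G s) ^\<^sub>m l)) =
      (\<Sum>s\<in>S. \<Sum>w\<in>closed_walks G l. bit_sign (edge_dot G s (parity_vector (snd w))))"
    unfolding trace_signed_adj_pow[OF G vs] using arcs
    by (intro sum.cong) (auto simp: walk_sign_signing_of[OF fin])
  also have "\<dots> = (\<Sum>w\<in>closed_walks G l. f (parity_vector (snd w)))"
    unfolding f_def by (rule sum.swap)
  also have "\<dots> = (\<Sum>w\<in>{w \<in> closed_walks G l. parity_vector (snd w) \<in> W}. f (parity_vector (snd w)))"
    by (intro sum.mono_neutral_right ballI f_out) (auto simp: finw parity)
  also have "\<dots> = (\<Sum>z\<in>W. \<Sum>w\<in>{w \<in> {w \<in> closed_walks G l. parity_vector (snd w) \<in> W}.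
      parity_vector (snd w) = z}. f (parity_vector (snd w)))"
    by (rule sum.group[symmetric]) (auto simp: finw W)
  also have "\<dots> = (\<Sum>z\<in>W. f z * real (walk_count G l z))"
  proof (rule sum.cong)
    fix z assume "z \<in> W"
    then have "{w \<in> {w \<in> closed_walks G l. parity_vector (snd w) \<in> W}. parity_vector (snd w) = z} =
        {(u, p) \<in> closed_walks G l. parity_vector p = z}"
      by auto
    moreover have "(\<Sum>w\<in>{(u, p) \<in> closed_walks G l. parity_vector p = z}. f (parity_vector (snd w))) =
        (\<Sum>w\<in>{(u, p) \<in> closed_walks G l. parity_vector p = z}. f z)"
      by (intro sum.cong) auto
    ultimately show "(\<Sum>w\<in>{w \<in> {w \<in> closed_walks G l. parity_vector (snd w) \<in> W}.
        parity_vector (snd w) = z}. f (parity_vector (snd w))) = f z * real (walk_count G l z)"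
      by (simp only: walk_count_def) simp
  qed simp
  also have "\<dots> = real (card S) * (\<Sum>z\<in>W. bit_sign (\<pi> z) * real (walk_count G l z))"
    by (simp add: f_in sum_distrib_left mult.assoc)
  finally show ?thesis .
qed


section \<open>Spectral radius and trace\<close>

lemma pow_mat_add:
  fixes A :: "'a::semiring_1 mat"
  assumes A: "A \<in> carrier_mat n n"
  shows "A ^\<^sub>m (k + l) = A ^\<^sub>m k * A ^\<^sub>m l"
proof (induction l)
  case 0
  have "A ^\<^sub>m k * 1\<^sub>m n = A ^\<^sub>m k"
    by (rule right_mult_one_mat[OF pow_carrier_mat[OF A]])
  moreover have "dim_row A = n"
    using A by simp
  ultimately show ?case by simp
next
  case (Suc l)
  then show ?case
    using A by (simp add: assoc_mult_mat[of _ n n _ n _ n] pow_carrier_mat)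
qed

lemma transpose_pow_mat:
  fixes A :: "'a::comm_semiring_1 mat"
  assumes A: "A \<in> carrier_mat n n"
  shows "transpose_mat (A ^\<^sub>m k) = transpose_mat A ^\<^sub>m k"
proof (induction k)
  case 0
  then show ?case using A by simp
next
  case (Suc k)
  have T: "transpose_mat A \<in> carrier_mat n n"
    using A by simp
  have "transpose_mat (A ^\<^sub>m Suc k) = transpose_mat A * transpose_mat A ^\<^sub>m k"
    using A Suc by (simp add: transpose_mult[of _ n n _ n] pow_carrier_mat)
  \<comment> \<open>Transposition moves the new factor to the left, whereas the recursion of the
    power has it on the right; \<open>pow_mat_add\<close> with first exponent 1 exchanges the
    sides.\<close>
  also have "\<dots> = transpose_mat A ^\<^sub>m 1 * transpose_mat A ^\<^sub>m k"
    using T by simp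
  also have "\<dots> = transpose_mat A ^\<^sub>m Suc k"
    unfolding pow_mat_add[OF T, symmetric] by simp
  finally show ?case .
qed

lemma mat_trace_square_symmetric:
  fixes B :: "'a::comm_semiring_1 mat"
  assumes B: "B \<in> carrier_mat n n" "transpose_mat B = B"
  shows "mat_trace (B * B) = (\<Sum>i<n. \<Sum>j<n. (B $$ (i, j))\<^sup>2)"
proof -
  have sym: "B $$ (j, i) = B $$ (i, j)" if "i < n" "j < n" for i j
    using that B index_transpose_mat(1)[of j B i] by simp
  show ?thesis
    using B by (simp add: mat_trace_def scalar_prod_def atLeast0LessThan sym power2_eq_square)
qed

text \<open>Cauchy-Schwarz for each row of \<open>B\<close>, then summation over the rows. The
  vector is complex because the eigenvectors below are taken over the complex numbers.\<close>

lemma norm_mult_mat_vec_le: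
  fixes B :: "real mat" and v :: "complex vec"
  assumes B: "B \<in> carrier_mat n n" and v: "v \<in> carrier_vec n"
  shows "(\<Sum>i<n. (cmod ((map_mat complex_of_real B *\<^sub>v v) $ i))\<^sup>2) \<le>
    (\<Sum>i<n. \<Sum>j<n. (B $$ (i, j))\<^sup>2) * (\<Sum>j<n. (cmod (v $ j))\<^sup>2)"
proof -
  have "(cmod ((map_mat complex_of_real B *\<^sub>v v) $ i))\<^sup>2 \<le>
      (\<Sum>j<n. (B $$ (i, j))\<^sup>2) * (\<Sum>j<n. (cmod (v $ j))\<^sup>2)" if i: "i < n" for i
  proof -
    have "cmod ((map_mat complex_of_real B *\<^sub>v v) $ i) = cmod (\<Sum>j<n. of_real (B $$ (i, j)) * v $ j)"
      using i B v by (simp add: scalar_prod_def atLeast0LessThan)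
    also have "\<dots> \<le> (\<Sum>j<n. \<bar>B $$ (i, j)\<bar> * \<bar>cmod (v $ j)\<bar>)"
      by (rule order.trans[OF norm_sum]) (simp add: norm_mult)
    also have "\<dots> \<le> L2_set (\<lambda>j. B $$ (i, j)) {..<n} * L2_set (\<lambda>j. cmod (v $ j)) {..<n}"
      by (rule L2_set_mult_ineq)
    finally have "(cmod ((map_mat complex_of_real B *\<^sub>v v) $ i))\<^sup>2 \<le>
        (L2_set (\<lambda>j. B $$ (i, j)) {..<n} * L2_set (\<lambda>j. cmod (v $ j)) {..<n})\<^sup>2"
      by (rule power_mono) simp
    then show ?thesis
      by (simp add: power_mult_distrib L2_set_def sum_nonneg)
  qed
  then show ?thesis
    unfolding sum_distrib_right by (intro sum_mono) simp
qed

text \<open>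
  For an eigenvector \<open>v\<close> of \<open>A\<close> and \<open>B = A\<^sup>k\<close>, the trace of \<open>B\<^sup>2\<close> is the squared Frobenius norm
  of \<open>B\<close>, which bounds \<open>\<parallel>B v\<parallel>\<^sup>2 / \<parallel>v\<parallel>\<^sup>2\<close>; this avoids diagonalising \<open>A\<close>.
\<close>

lemma spectral_radius_power_le_trace:
  fixes A :: "real mat"
  assumes A: "A \<in> carrier_mat n n" "transpose_mat A = A" and n: "n > 0"
  shows "spectral_radius (map_mat complex_of_real A) ^ (2 * k) \<le> mat_trace (A ^\<^sub>m (2 * k))"
proof -
  let ?C = "map_mat complex_of_real A"
  define B where "B = A ^\<^sub>m k"
  have C: "?C \<in> carrier_mat n n" and B: "B \<in> carrier_mat n n" "transpose_mat B = B"
    using A by (simp_all add: B_def pow_carrier_mat transpose_pow_mat[OF A(1)])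
  \<comment> \<open>Positive dimension ensures that the maximum defining the spectral radius is
    attained.\<close>
  obtain c where c: "c \<in> spectrum ?C" "spectral_radius ?C = cmod c"
    using spectral_radius_mem_max(1)[OF C n] by auto
  then obtain v where ev: "eigenvector ?C v c"
    by (auto simp: spectrum_def eigenvalue_def)
  then have v: "v \<in> carrier_vec n" "v \<noteq> 0\<^sub>v n"
    using A by (auto simp: eigenvector_def)
  define N where "N = (\<Sum>j<n. (cmod (v $ j))\<^sup>2)"
  \<comment> \<open>A nonzero coordinate makes \<open>N\<close> positive, so that it can be
    cancelled below.\<close>
  obtain j where "j < n" "v $ j \<noteq> 0"
    using v by (metis eq_vecI carrier_vecD index_zero_vec)
  then have N: "N > 0"
    unfolding N_def by (intro sum_pos2[of _ j]) auto
  have Bv: "map_mat complex_of_real B *\<^sub>v v = c ^ k \<cdot>\<^sub>v v"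
    unfolding B_def using eigenvector_pow[OF C ev]
    by (simp add: of_real_hom.mat_hom_pow[OF A(1)])
  have "cmod c ^ (2 * k) * N = (\<Sum>i<n. (cmod ((map_mat complex_of_real B *\<^sub>v v) $ i))\<^sup>2)"
    unfolding Bv N_def sum_distrib_left using v
    by (intro sum.cong) (simp_all add: norm_mult norm_power power_mult_distrib mult.commute flip: power_mult)
  also have "\<dots> \<le> (\<Sum>i<n. \<Sum>j<n. (B $$ (i, j))\<^sup>2) * N"
    unfolding N_def by (rule norm_mult_mat_vec_le[OF B(1) v(1)])
  finally have "cmod c ^ (2 * k) \<le> (\<Sum>i<n. \<Sum>j<n. (B $$ (i, j))\<^sup>2)"
    using N by simp
  also have "\<dots> = mat_trace (A ^\<^sub>m (2 * k))"
    by (simp add: mat_trace_square_symmetric[OF B] mult_2 pow_mat_add[OF A(1)] flip: B_def)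
  finally show ?thesis
    using c by simp
qed


section \<open>Covering by the regular tree\<close>

text \<open>The count of \<open>y\<close> is the sum of the counts over its fibre. This carries
  evenness along the covering map, which may identify different edges of the tree.\<close>

lemma even_count_list_map:
  assumes "\<And>x. even (count_list xs x)"
  shows "even (count_list (map f xs) y)"
proof -
  let ?ys = "filter (\<lambda>x. f x = y) xs"
  have "count_list (map f xs) y = length ?ys"
    by (induction xs) auto
  also have "\<dots> = (\<Sum>x\<in>set ?ys. count_list ?ys x)"
    by (simp add: sum_count_set)
  also have "\<dots> = (\<Sum>x\<in>set ?ys. count_list xs x)"
  proof (rule sum.cong)
    fix x assume "x \<in> set ?ys"
    then have "f x = y" by simp
    then show "count_list ?ys x = count_list xs x"
      by (induction xs) auto
  qed simp
  finally show ?thesis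
    using assms by (simp add: dvd_sum)
qed

text \<open>The crossed matching of the endpoints would give \<open>u = b # a # u\<close>, which
  lengths exclude.\<close>

lemma doubleton_Cons_eq_iff: "{x, b # x} = {u, a # u} \<longleftrightarrow> x = u \<and> b = a"
  by (auto simp: doubleton_eq_iff)

text \<open>Here \<open>\<noteq>\<close> is exclusive or: prepending a letter changes the side of
  the edge \<open>{u, a # u}\<close> exactly when it traverses this edge.\<close>

lemma suffix_Cons_Cons_iff: "suffix (a # u) (b # x) \<longleftrightarrow> (x = u \<and> b = a) \<noteq> suffix (a # u) x"
  by (auto simp: suffix_Cons dest: suffix_length_le)

text \<open>
  Removing the edge \<open>{u, a # u}\<close> cuts off the words with suffix \<open>a # u\<close>.
\<close>

lemma tree_walk_edge_parity:
  assumes "set p \<subseteq> parcs (regular_tree d)" "pcas x p y"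
  shows "even (count_list (map uedge p) {u, a # u}) \<longleftrightarrow> suffix (a # u) x = suffix (a # u) y"
  using assms
proof (induction p arbitrary: x)
  case (Cons e p)
  obtain x' where e: "e = (x, x')"
    using Cons.prems by (cases e) auto
  have IH: "even (count_list (map uedge p) {u, a # u}) \<longleftrightarrow> suffix (a # u) x' = suffix (a # u) y"
    using Cons e by simp
  \<comment> \<open>A step leads away from the root or towards it; either way its edge has the form
    \<open>{w, b # w}\<close>, and the suffix condition toggles precisely at the edge
    \<open>{u, a # u}\<close>.\<close>
  have "(\<exists>b. x' = b # x) \<or> (\<exists>b. x = b # x')"
    using Cons.prems e by (auto simp: regular_tree_def)
  then show ?case
  proof (elim disjE exE)
    fix b assume x': "x' = b # x"
    then have "uedge e = {x, b # x}"
      by (simp add: e uedge_def)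
    then show ?thesis
      using IH x' by (auto simp: doubleton_Cons_eq_iff suffix_Cons_Cons_iff)
  next
    fix b assume x: "x = b # x'"
    then have "uedge e = {x', b # x'}"
      by (auto simp: e uedge_def)
    then show ?thesis
      using IH x by (auto simp: doubleton_Cons_eq_iff suffix_Cons_Cons_iff)
  qed
qed simp

text \<open>Start and end coincide and thus lie on the same side of every tree edge; a set that is
  no tree edge is counted 0 times.\<close>

lemma tree_closed_walk_even:
  assumes "set p \<subseteq> parcs (regular_tree d)" "pcas x p x"
  shows "even (count_list (map uedge p) e)"
proof (cases "e \<in> uedge ` parcs (regular_tree d)")
  case True
  then obtain u a where "e = {u, a # u}"
    by (fastforce simp: regular_tree_def uedge_def insert_commute)
  then show ?thesis
    using tree_walk_edge_parity[OF assms] by simp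
next
  case False
  then have "e \<notin> set (map uedge p)"
    using assms by auto
  then show ?thesis by simp
qed

section \<open>Construction of the covering map\<close>

definition port_labelling :: "'a pair_pre_digraph \<Rightarrow> nat \<Rightarrow> 'a \<Rightarrow> nat \<Rightarrow> 'a \<Rightarrow> nat \<Rightarrow> 'a" where
  "port_labelling G d u b w =
     (SOME f. bij_betw f {..<d} {x. (u, x) \<in> parcs G} \<and> (b < d \<and> (u, w) \<in> parcs G \<longrightarrow> f b = w))"

text \<open>Regularity gives some bijection \<open>g\<close> from letters to neighbours; exchanging
  \<open>b\<close> with the letter that \<open>g\<close> sends to \<open>w\<close> enforces the
  prescribed value.\<close>

lemma port_labelling:
  assumes G: "pair_fin_digraph G" and reg: "regular G d" and u: "u \<in> pverts G"
  shows "bij_betw (port_labelling G d u b w) {..<d} {x. (u, x) \<in> parcs G}"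
    and "b < d \<Longrightarrow> (u, w) \<in> parcs G \<Longrightarrow> port_labelling G d u b w b = w"
proof -
  interpret pair_fin_digraph G by fact
  let ?N = "{x. (u, x) \<in> parcs G}"
  have out: "out_arcs (with_proj G) u = Pair u ` ?N"
    by (auto simp: out_arcs_def)
  have "finite (Pair u ` ?N)"
    by (rule finite_subset[OF _ pair_finite_arcs]) auto
  then have fin: "finite ?N"
    by (rule finite_imageD) (simp add: inj_on_def)
  have "card (Pair u ` ?N) = d"
    using reg u unfolding regular_def out_degree_def out[symmetric] by blast
  then have "card ?N = d"
    by (simp add: card_image inj_on_def)
  then obtain g where g: "bij_betw g {..<d} ?N"
    using ex_bij_betw_nat_finite[OF fin] by (auto simp: atLeast0LessThan)
  have "\<exists>f. bij_betw f {..<d} ?N \<and> (b < d \<and> (u, w) \<in> parcs G \<longrightarrow> f b = w)"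
  proof (cases "b < d \<and> (u, w) \<in> parcs G")
    case True
    then have "w \<in> g ` {..<d}"
      using g by (simp add: bij_betw_def)
    then obtain c where c: "c < d" "w = g c"
      by auto
    have "bij_betw (g \<circ> transpose b c) {..<d} ?N"
      using g True c by (simp add: bij_betw_swap_iff)
    then show ?thesis
      using c by (intro exI[of _ "g \<circ> transpose b c"]) simp
  qed (use g in auto)
  from someI_ex[OF this] show "bij_betw (port_labelling G d u b w) {..<d} ?N"
    and "b < d \<Longrightarrow> (u, w) \<in> parcs G \<Longrightarrow> port_labelling G d u b w b = w"
    unfolding port_labelling_def by blast+
qed

text \<open>
  A covering map with the root over \<open>v\<close>.  The labelling of the neighbours of the image of
  \<open>b # w\<close> gives the label \<open>b\<close> to the image of the parent \<open>w\<close>.  The root has no parent, which the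
  invalid label \<open>d\<close> expresses.
\<close>

fun tree_cover :: "'a pair_pre_digraph \<Rightarrow> nat \<Rightarrow> 'a \<Rightarrow> nat list \<Rightarrow> 'a" where
  "tree_cover G d v [] = v"
| "tree_cover G d v [a] = port_labelling G d v d v a"
| "tree_cover G d v (a # b # w) =
     port_labelling G d (tree_cover G d v (b # w)) b (tree_cover G d v w) a"

lemma tree_verts_ConsD: "a # w \<in> tree_verts d \<Longrightarrow> a < d \<and> w \<in> tree_verts d"
  by (auto simp: tree_verts_def distinct_adj_Cons)

lemma tree_cover_arc:
  assumes "pair_fin_digraph G" "regular G d" "v \<in> pverts G" "a # w \<in> tree_verts d"
  shows "(tree_cover G d v w, tree_cover G d v (a # w)) \<in> parcs G"
  using assms(4)
proof (induction w arbitrary: a)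
  case Nil
  then show ?case
    using bij_betwE[OF port_labelling(1)[OF assms(1-3)]] tree_verts_ConsD[OF Nil] by auto
next
  case (Cons b w)
  interpret pair_fin_digraph G by fact
  \<comment> \<open>The induction hypothesis makes this image the head of an arc, hence a vertex, so
    that its labelling is a bijection onto its neighbours.\<close>
  have "tree_cover G d v (b # w) \<in> pverts G"
    using Cons tree_verts_ConsD in_arcsD2 by metis
  then show ?case
    using bij_betwE[OF port_labelling(1)[OF assms(1,2)]] tree_verts_ConsD[OF Cons.prems] by auto
qed

lemma tree_cover_hom:
  assumes "pair_graph G" "regular G d" "v \<in> pverts G" "(x, y) \<in> parcs (regular_tree d)"
  shows "(tree_cover G d v x, tree_cover G d v y) \<in> parcs G"
proof -
  interpret pair_graph G by fact
  have fin: "pair_fin_digraph G" by unfold_locales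
  have sym: "(p, q) \<in> parcs G \<Longrightarrow> (q, p) \<in> parcs G" for p q
    using pair_sym_arcs by (auto simp: symmetric_def dest: symD)
  show ?thesis
    using assms(4) tree_cover_arc[OF fin assms(2,3)] sym by (auto simp: regular_tree_def)
qed

text \<open>A single injective labelling \<open>f\<close> governs all neighbours of
  \<open>x\<close>: the child \<open>a # x\<close> is sent to \<open>f a\<close>, and if
  \<open>x = b # w\<close>, the parent \<open>w\<close> is sent to \<open>f b\<close>.\<close>

lemma tree_cover_locally_injective:
  assumes G: "pair_graph G" and reg: "regular G d" and v: "v \<in> pverts G"
    and x: "(x, y) \<in> parcs (regular_tree d)" "(x, z) \<in> parcs (regular_tree d)"
    and eq: "tree_cover G d v y = tree_cover G d v z"
  shows "y = z"
proof -
  interpret pair_graph G by fact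
  have fin: "pair_fin_digraph G" by unfold_locales
  have "tree_cover G d v x \<in> pverts G"
    using tree_cover_hom[OF G reg v x(1)] in_arcsD1 by blast
  note port = port_labelling[OF fin reg this]
  obtain f where f: "inj_on f {..<d}" "\<And>a. tree_cover G d v (a # x) = f a"
    "\<And>b w. x = b # w \<Longrightarrow> tree_cover G d v w = f b"
  proof (cases x)
    case Nil
    then show ?thesis
      using port(1)[of d v] by (intro that[of "port_labelling G d v d v"]) (auto simp: bij_betw_def)
  next
    case (Cons b w)
    have "b < d" and "(x, w) \<in> parcs (regular_tree d)"
      using x Cons by (auto simp: regular_tree_def dest: tree_verts_ConsD)
    then have "port_labelling G d (tree_cover G d v x) b (tree_cover G d v w) b = tree_cover G d v w"
      using port(2) tree_cover_hom[OF G reg v] by blast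
    then show ?thesis
      using port(1) Cons
      by (intro that[of "port_labelling G d (tree_cover G d v x) b (tree_cover G d v w)"])
        (auto simp: bij_betw_def)
  qed
  have "\<exists>a<d. tree_cover G d v q = f a \<and> (q = a # x \<or> x = a # q)"
    if "(x, q) \<in> parcs (regular_tree d)" for q
    using that f(2,3) by (auto simp: regular_tree_def dest: tree_verts_ConsD)
  then obtain a b where ab: "a < d" "tree_cover G d v y = f a" "y = a # x \<or> x = a # y"
    "b < d" "tree_cover G d v z = f b" "z = b # x \<or> x = b # z"
    using x by meson
  then have "a = b"
    using f(1) eq by (simp add: inj_on_eq_iff)
  \<comment> \<open>A common letter could still belong to a child and the parent; the child would
    then start with two equal letters.\<close>
  moreover have "distinct_adj y" "distinct_adj z"
    using x by (auto simp: regular_tree_def tree_verts_def)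
  ultimately show ?thesis
    using ab by auto
qed

section \<open>Images of tree walks under the covering map\<close>

lemma tree_cover_walk:
  assumes "pair_graph G" "regular G d" "v \<in> pverts G"
    and "set p \<subseteq> parcs (regular_tree d)" "pcas x p y"
  shows "set (map (map_prod (tree_cover G d v) (tree_cover G d v)) p) \<subseteq> parcs G"
    and "pcas (tree_cover G d v x) (map (map_prod (tree_cover G d v) (tree_cover G d v)) p)
      (tree_cover G d v y)"
proof -
  show "set (map (map_prod (tree_cover G d v) (tree_cover G d v)) p) \<subseteq> parcs G"
    using assms(4) tree_cover_hom[OF assms(1-3)] by auto
  show "pcas (tree_cover G d v x) (map (map_prod (tree_cover G d v) (tree_cover G d v)) p)
      (tree_cover G d v y)"
    using assms(5) by (induction p arbitrary: x) auto
qed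

text \<open>Uniqueness of lifts: two tree walks with the same start and the same image agree arc by
  arc, by local injectivity.\<close>

lemma tree_cover_walk_injective:
  assumes "pair_graph G" "regular G d" "v \<in> pverts G"
    and "set p \<subseteq> parcs (regular_tree d)" "pcas x p y"
    and "set q \<subseteq> parcs (regular_tree d)" "pcas x q z"
    and "map (map_prod (tree_cover G d v) (tree_cover G d v)) p =
      map (map_prod (tree_cover G d v) (tree_cover G d v)) q"
  shows "p = q"
  using assms(4-8)
proof (induction p arbitrary: x q)
  case (Cons e p)
  then obtain f q' where q: "q = f # q'"
    by (cases q) auto
  obtain e' f' where ef: "e = (x, e')" "f = (x, f')"
    using Cons.prems q by (cases e; cases f) auto
  have "e' = f'"
    using Cons.prems q ef tree_cover_locally_injective[OF assms(1-3)] by auto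
  then show ?case
    using Cons q ef by auto
qed simp

lemma of_nat_bit_eq_0: "even n \<Longrightarrow> (of_nat n :: bit) = 0"
  by (auto elim!: evenE)

lemma tree_walk_count_le:
  assumes G: "pair_graph G" and reg: "regular G d" and v: "v \<in> pverts G"
  shows "tree_walk_count d l \<le> card {p \<in> arc_walks G l v v. parity_vector p = 0}"
proof -
  interpret pair_graph G by fact
  let ?c = "tree_cover G d v"
  let ?M = "map (map_prod ?c ?c)"
  \<comment> \<open>The empty word is a vertex of the tree, so \<open>awalk\<close> reduces to the
    conditions in \<open>arc_walks\<close>.\<close>
  have eq: "{p. pre_digraph.awalk (with_proj (regular_tree d)) [] p [] \<and> length p = l} =
      arc_walks (regular_tree d) l [] []"
    by (auto simp: arc_walks_def pre_digraph.awalk_def cas_with_proj_eq regular_tree_def tree_verts_def)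
  have "card (arc_walks (regular_tree d) l [] []) \<le> card {p \<in> arc_walks G l v v. parity_vector p = 0}"
  proof (rule card_inj_on_le)
    show "inj_on ?M (arc_walks (regular_tree d) l [] [])"
      using tree_cover_walk_injective[OF G reg v]
      by (intro inj_onI) (auto simp: arc_walks_def)
    show "finite {p \<in> arc_walks G l v v. parity_vector p = 0}"
      by (simp add: finite_arc_walks pair_finite_arcs)
    show "?M ` arc_walks (regular_tree d) l [] [] \<subseteq> {p \<in> arc_walks G l v v. parity_vector p = 0}"
    proof safe
      fix p assume p: "p \<in> arc_walks (regular_tree d) l [] []"
      show "?M p \<in> arc_walks G l v v"
        using p tree_cover_walk[OF G reg v, of p "[]" "[]"] by (auto simp: arc_walks_def)
      \<comment> \<open>The edge of an image arc is the image of the tree edge as a set, which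
        brings the walk into the form of \<open>even_count_list_map\<close>.\<close>
      have "map uedge (?M p) = map ((`) ?c) (map uedge p)"
        by (auto simp: uedge_def)
      moreover have "even (count_list (map uedge p) e)" for e
        using p tree_closed_walk_even by (auto simp: arc_walks_def)
      ultimately have "even (count_list (map uedge (?M p)) e)" for e
        using even_count_list_map by metis
      then show "parity_vector (?M p) = 0"
        by (simp add: parity_vector_def fun_eq_iff of_nat_bit_eq_0 del: map_map)
    qed
  qed
  then show ?thesis
    by (simp add: tree_walk_count_def eq)
qed

lemma walk_count_0_ge:
  assumes G: "pair_graph G" and reg: "regular G d"
  shows "card (pverts G) * tree_walk_count d l \<le> walk_count G l 0"
proof -
  interpret pair_graph G by fact
  have "{(u, p) \<in> closed_walks G l. parity_vector p = 0} =
      (SIGMA u : pverts G. {p \<in> arc_walks G l u u. parity_vector p = 0})"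
    by (auto simp: closed_walks_eq)
  then have "walk_count G l 0 = (\<Sum>u\<in>pverts G. card {p \<in> arc_walks G l u u. parity_vector p = 0})"
    unfolding walk_count_def
    by (simp add: card_SigmaI pair_finite_verts finite_arc_walks pair_finite_arcs)
  moreover have "(\<Sum>u\<in>pverts G. tree_walk_count d l) \<le> \<dots>"
    by (intro sum_mono tree_walk_count_le G reg)
  ultimately show ?thesis by simp
qed


section \<open>Averages over signings\<close>

lemma signing_of_in_signings: "signing_of G s \<in> signings G"
  by (auto simp: signing_of_def signings_def bit_sign_def)

lemma bit_sign_inject: "bit_sign a = bit_sign b \<Longrightarrow> a = b"
  by (cases "a = 0"; cases "b = 0") (simp_all add: bit_sign_def)

lemma bij_betw_signing_of: "bij_betw (signing_of G) (edge_vectors G) (signings G)"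
proof (intro bij_betwI')
  fix x y assume xy: "x \<in> edge_vectors G" "y \<in> edge_vectors G"
  show "signing_of G x = signing_of G y \<longleftrightarrow> x = y"
  proof
    assume eq: "signing_of G x = signing_of G y"
    show "x = y"
    proof
      fix e
      show "x e = y e"
      proof (cases "e \<in> edges G")
        case True
        then show ?thesis
          using fun_cong[OF eq, of e] by (simp add: signing_of_def bit_sign_inject)
      qed (use xy in \<open>simp add: edge_vectors_def\<close>)
    qed
  qed simp
next
  fix \<sigma> assume \<sigma>: "\<sigma> \<in> signings G"
  let ?s = "\<lambda>e. of_bool (e \<in> edges G \<and> \<sigma> e = -1) :: bit"
  have "\<sigma> = signing_of G ?s"
  proof
    fix e
    show "\<sigma> e = signing_of G ?s e"
    proof (cases "e \<in> edges G")
      case True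
      then have "\<sigma> e = 1 \<or> \<sigma> e = -1"
        using \<sigma> by (auto simp: signings_def)
      then show ?thesis
        using True by (auto simp: signing_of_def bit_sign_def)
    qed (use \<sigma> in \<open>auto simp: signings_def signing_of_def\<close>)
  qed
  moreover have "?s \<in> edge_vectors G"
    by (simp add: edge_vectors_def)
  ultimately show "\<exists>x\<in>edge_vectors G. \<sigma> = signing_of G x"
    by blast
qed (rule signing_of_in_signings)

lemma switch_at_in_signings:
  assumes "\<sigma> \<in> signings G"
  shows "switch_at G v \<sigma> \<in> signings G"
  using assms by (fastforce simp: switch_at_def signings_def PiE_iff)

text \<open>Switching keeps the values in \<open>{1, -1}\<close>; the inclusion makes the set under
  the minimum finite.\<close>

lemma switching_family_subset_signings: "\<Union> (switching_family G L) \<subseteq> signings G"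
proof -
  have "\<tau> \<in> signings G" if "(\<sigma>, \<tau>) \<in> switching G" "\<sigma> \<in> signings G" for \<sigma> \<tau>
    using that unfolding switching_def
    by (induction rule: rtrancl_induct) (auto intro: switch_at_in_signings)
  then show ?thesis
    by (auto simp: switching_family_def quotient_def signing_of_in_signings)
qed

lemma signing_of_in_switching_family:
  assumes "s \<in> solutions G L"
  shows "signing_of G s \<in> \<Union> (switching_family G L)"
proof -
  have "(signing_of G s, signing_of G s) \<in> switching G"
    by (simp add: switching_def)
  then show ?thesis
    using assms by (auto simp: switching_family_def quotient_def)
qed

section \<open>The coset of solutions and its form on the cycle span\<close>

lemma cycle_vector_in_edge_vectors:
  assumes "p \<in> constraint_cycles G L"
  shows "cycle_vector p \<in> edge_vectors G"
  using assms
  by (auto simp: constraint_cycles_def pre_digraph.cycle_def pre_digraph.awalk_def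
      cycle_vector_def edge_vectors_def edges_def)

lemma cycle_span_subset_edge_vectors: "cycle_span G L \<subseteq> edge_vectors G"
proof -
  have "bitvec.subspace (edge_vectors G)"
    by (auto simp: bitvec.subspace_def edge_vectors_def vscale_def)
  then show ?thesis
    unfolding cycle_span_def
    by (intro bitvec.span_minimal) (auto intro: cycle_vector_in_edge_vectors)
qed

lemma zero_in_cycle_span: "0 \<in> cycle_span G L"
  by (simp only: cycle_span_def bitvec.span_zero)

text \<open>Together with \<open>is_cycle_form_unique\<close> this shows that every solution pairs
  with the span as \<open>\<pi>\<close> does.\<close>

lemma is_cycle_form_edge_dot:
  assumes "s \<in> solutions G L"
  shows "is_cycle_form G L (edge_dot G s)"
proof -
  have "edge_dot G s (vscale c x) = c * edge_dot G s x" for c x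
    unfolding edge_dot_def vscale_def sum_distrib_left mult.left_commute[of c] ..
  then show ?thesis
    using assms unfolding is_cycle_form_def solutions_def by (auto simp: edge_dot_add_right simp del: add_bit_eq_xor)
qed

lemma cycle_form_zero:
  assumes "is_cycle_form G L \<pi>"
  shows "\<pi> 0 = 0"
proof -
  have "\<pi> (vscale 0 0) = 0 * \<pi> 0"
    using assms zero_in_cycle_span unfolding is_cycle_form_def by blast
  moreover have "vscale 0 0 = (0 :: 'a set \<Rightarrow> bit)"
    by (simp add: vscale_def fun_eq_iff)
  ultimately show ?thesis
    by (simp only: mult_zero_left)
qed

lemma sum_trace_solutions:
  assumes G: "pair_fin_digraph G" and vs: "distinct vs" "set vs = pverts G"
    and \<pi>: "is_cycle_form G L \<pi>"
  shows "(\<Sum>s\<in>solutions G L. mat_trace (signed_adj G vs (signing_of G s) ^\<^sub>m l)) =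
    real (card (solutions G L)) * (\<Sum>z\<in>cycle_span G L. bit_sign (\<pi> z) * real (walk_count G l z))"
proof (rule sum_trace_signing_of[OF G vs])
  interpret pair_fin_digraph G by fact
  have fin: "finite (edges G)"
    by (simp add: edges_def pair_finite_arcs)
  show "finite (cycle_span G L)"
    by (rule finite_subset[OF cycle_span_subset_edge_vectors finite_edge_vectors[OF fin]])
  show "edge_dot G s z = \<pi> z" if "s \<in> solutions G L" "z \<in> cycle_span G L" for s z
    using is_cycle_form_unique[OF is_cycle_form_edge_dot \<pi>] that by blast
  fix z assume z: "z \<in> edge_vectors G - cycle_span G L"
  have "cycle_vector ` constraint_cycles G L \<subseteq> edge_vectors G"
    by (auto intro: cycle_vector_in_edge_vectors)
  then obtain t where t: "t \<in> edge_vectors G" "edge_dot G t z = 1"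
    "\<And>b. b \<in> cycle_vector ` constraint_cycles G L \<Longrightarrow> edge_dot G t b = 0"
    using separating_edge_vector[OF fin] z unfolding cycle_span_def by (metis DiffE)
  \<comment> \<open>Since \<open>t\<close> is orthogonal to all constraint cycles, translation by it
    preserves the system.\<close>
  have "s + t \<in> solutions G L" if "s \<in> solutions G L" for s
    using that t unfolding solutions_def by (simp add: edge_vectors_add edge_dot_add_left)
  then show "\<exists>t. (\<forall>s\<in>solutions G L. s + t \<in> solutions G L) \<and> edge_dot G t z = 1"
    using t by blast
qed

text \<open>The case of all edge vectors with \<open>W = {0}\<close>: a nonzero \<open>z\<close> is
  separated from 0 by the unit vector of an edge at which it is 1.\<close>

lemma signing_average_trace:
  assumes G: "pair_fin_digraph G" and vs: "distinct vs" "set vs = pverts G"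
  shows "signing_average G (\<lambda>\<sigma>. mat_trace (signed_adj G vs \<sigma> ^\<^sub>m l)) = real (walk_count G l 0)"
proof -
  interpret pair_fin_digraph G by fact
  have fin: "finite (edges G)"
    by (simp add: edges_def pair_finite_arcs)
  have "(0 :: 'a set \<Rightarrow> bit) \<in> edge_vectors G"
    by (simp add: edge_vectors_def)
  then have pos: "card (edge_vectors G) > 0"
    using finite_edge_vectors[OF fin] card_gt_0_iff by blast
  have "(\<Sum>s\<in>edge_vectors G. mat_trace (signed_adj G vs (signing_of G s) ^\<^sub>m l)) =
      real (card (edge_vectors G)) * (\<Sum>z\<in>{0}. bit_sign 0 * real (walk_count G l z))"
  proof (rule sum_trace_signing_of[OF G vs])
    fix z assume z: "z \<in> edge_vectors G - {0}"
    then obtain e where e: "z e = 1"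
      by (auto simp: fun_eq_iff)
    then have "e \<in> edges G"
      using z by (auto simp: edge_vectors_def)
    moreover from this have "(\<lambda>f. of_bool (f = e)) \<in> edge_vectors G"
      by (auto simp: edge_vectors_def)
    ultimately show "\<exists>t. (\<forall>s\<in>edge_vectors G. s + t \<in> edge_vectors G) \<and> edge_dot G t z = 1"
      using e edge_dot_indicator(1)[OF fin] edge_vectors_add by metis
  qed (auto simp: edge_dot_def)
  moreover have "(\<Sum>s\<in>edge_vectors G. mat_trace (signed_adj G vs (signing_of G s) ^\<^sub>m l)) =
      (\<Sum>\<sigma>\<in>signings G. mat_trace (signed_adj G vs \<sigma> ^\<^sub>m l))"
    by (rule sum.reindex_bij_betw[OF bij_betw_signing_of])
  ultimately show ?thesis
    using pos bij_betw_same_card[OF bij_betw_signing_of[of G]]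
    by (simp add: signing_average_def bit_sign_def)
qed

lemma transpose_signed_adj:
  assumes "pair_graph G"
  shows "transpose_mat (signed_adj G vs \<sigma>) = signed_adj G vs \<sigma>"
proof -
  interpret pair_graph G by fact
  have "(x, y) \<in> parcs G \<longleftrightarrow> (y, x) \<in> parcs G" for x y
    using pair_sym_arcs by (auto simp: symmetric_def dest: symD)
  then show ?thesis
    by (intro eq_matI) (auto simp: signed_adj_def insert_commute)
qed

text \<open>Some solution has a trace at most the mean \<open>?R\<close>, and its spectral radius is
  at least the minimum.\<close>

lemma min_signed_radius_le_family_bound:
  assumes G: "pair_graph G" and vs: "distinct vs" "set vs = pverts G" "vs \<noteq> []"
    and cons: "consistent G L" and \<pi>: "is_cycle_form G L \<pi>" and k: "k \<ge> 1"
  shows "(MIN \<sigma> \<in> \<Union> (switching_family G L). signed_radius G vs \<sigma>) \<le> family_bound G L \<pi> k"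
proof -
  interpret pair_graph G by fact
  have fin: "finite (edges G)"
    by (simp add: edges_def pair_finite_arcs)
  have G': "pair_fin_digraph G" by unfold_locales
  let ?S = "solutions G L"
  let ?m = "MIN \<sigma> \<in> \<Union> (switching_family G L). signed_radius G vs \<sigma>"
  let ?R = "\<Sum>z\<in>cycle_span G L. bit_sign (\<pi> z) * real (walk_count G (2 * k) z)"
  have "finite (signings G)"
    by (simp add: signings_def finite_PiE fin)
  then have finF: "finite (\<Union> (switching_family G L))"
    by (rule finite_subset[OF switching_family_subset_signings])
  have S: "finite ?S" "?S \<noteq> {}"
    using finite_edge_vectors[OF fin] cons by (auto simp: solutions_def consistent_def)
  define tr where "tr s = mat_trace (signed_adj G vs (signing_of G s) ^\<^sub>m (2 * k))" for s
  have "\<exists>s\<in>?S. tr s \<le> ?R"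
  proof (rule ccontr)
    assume "\<not> (\<exists>s\<in>?S. tr s \<le> ?R)"
    then have "(\<Sum>s\<in>?S. ?R) < (\<Sum>s\<in>?S. tr s)"
      using S by (intro sum_strict_mono) auto
    then show False
      using sum_trace_solutions[OF G' vs(1,2) \<pi>] by (simp add: tr_def)
  qed
  then obtain s where s: "s \<in> ?S" "tr s \<le> ?R" ..
  let ?\<rho> = "signed_radius G vs (signing_of G s)"
  have "?m \<le> ?\<rho>"
    using finF signing_of_in_switching_family[OF s(1)] by (intro Min_le) auto
  \<comment> \<open>An even root of an even power yields the absolute value, so the estimate passes
    through it.\<close>
  also have "?\<rho> \<le> \<bar>?\<rho>\<bar>" by simp
  also have "\<dots> = root (2 * k) (?\<rho> ^ (2 * k))"
    using k by (simp add: real_root_power_cancel flip: power_even_abs[of "2 * k" ?\<rho>])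
  also have "\<dots> \<le> root (2 * k) ?R"
    using spectral_radius_power_le_trace[OF signed_adj_carrier transpose_signed_adj[OF G],
        of vs "signing_of G s" k] vs(3) s(2) k
    by (simp add: signed_radius_def tr_def)
  finally show ?thesis
    by (simp add: family_bound_def)
qed

theorem corollary8:
  fixes G :: "'a pair_pre_digraph" and n L :: nat and vs :: "'a list"
    and \<pi> :: "('a set \<Rightarrow> bit) \<Rightarrow> bit"
  assumes "pair_graph G"
    and "Digraph_Component.connected (with_proj G)"
    and "card (pverts G) = n"
    and "distinct vs" and "set vs = pverts G"
    and "L > 0"
    and "consistent G L"
    and "is_cycle_form G L \<pi>"
  shows "(\<forall>k \<ge> 1. (MIN \<sigma> \<in> \<Union> (switching_family G L). signed_radius G vs \<sigma>)
                   \<le> family_bound G L \<pi> k) \<and>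
         (\<forall>d. regular G d \<longrightarrow> (\<forall>k \<ge> 1.
            signing_average G (\<lambda>\<sigma>. mat_trace (signed_adj G vs \<sigma> ^\<^sub>m (2 * k)))
              = real (walk_count G (2 * k) 0) \<and>
            walk_count G (2 * k) 0 \<ge> n * tree_walk_count d (2 * k) \<and>
            root (2 * k) (signing_average G (\<lambda>\<sigma>. mat_trace (signed_adj G vs \<sigma> ^\<^sub>m (2 * k))))
              \<ge> root (2 * k) (real (n * tree_walk_count d (2 * k))) \<and>
            (family_bound G L \<pi> k < root (2 * k) (real (n * tree_walk_count d (2 * k))) \<longleftrightarrow>
              (\<Sum>z \<in> cycle_span G L - {0}. bit_sign (\<pi> z) * real (walk_count G (2 * k) z))
                < - (real (walk_count G (2 * k) 0) - real (n * tree_walk_count d (2 * k))))))"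
proof (intro conjI allI impI)
  interpret pair_graph G by fact
  have G': "pair_fin_digraph G" by unfold_locales
  \<comment> \<open>Connectedness includes the existence of a vertex; this gives the matrix a
    positive dimension.\<close>
  have "vs \<noteq> []"
    using assms(2,5)
    by (auto simp: connected_def strongly_connected_def mk_symmetric_def)
  then show "(MIN \<sigma> \<in> \<Union> (switching_family G L). signed_radius G vs \<sigma>) \<le> family_bound G L \<pi> k"
    if "k \<ge> 1" for k
    using min_signed_radius_le_family_bound assms that by blast
  fix d k :: nat
  assume reg: "regular G d" and k: "k \<ge> 1"
  let ?N = "\<lambda>z. real (walk_count G (2 * k) z)"
  show avg: "signing_average G (\<lambda>\<sigma>. mat_trace (signed_adj G vs \<sigma> ^\<^sub>m (2 * k))) = ?N 0"
    by (rule signing_average_trace[OF G' assms(4,5)])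
  show le: "n * tree_walk_count d (2 * k) \<le> walk_count G (2 * k) 0"
    using walk_count_0_ge[OF assms(1) reg] assms(3) by simp
  show "root (2 * k) (signing_average G (\<lambda>\<sigma>. mat_trace (signed_adj G vs \<sigma> ^\<^sub>m (2 * k))))
      \<ge> root (2 * k) (real (n * tree_walk_count d (2 * k)))"
    unfolding avg using le k by (simp only: real_root_le_iff of_nat_le_iff)
  have "finite (edges G)"
    by (simp add: edges_def pair_finite_arcs)
  then have "finite (cycle_span G L)"
    using finite_subset[OF cycle_span_subset_edge_vectors finite_edge_vectors] by blast
  then have "(\<Sum>z\<in>cycle_span G L. bit_sign (\<pi> z) * ?N z) =
      bit_sign (\<pi> 0) * ?N 0 + (\<Sum>z\<in>cycle_span G L - {0}. bit_sign (\<pi> z) * ?N z)"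
    by (rule sum.remove[OF _ zero_in_cycle_span])
  \<comment> \<open>As \<open>\<pi> 0 = 0\<close>, the walks of parity vector 0 enter with a plus
    sign.\<close>
  then have split: "(\<Sum>z\<in>cycle_span G L. bit_sign (\<pi> z) * ?N z) =
      ?N 0 + (\<Sum>z\<in>cycle_span G L - {0}. bit_sign (\<pi> z) * ?N z)"
    by (simp only: cycle_form_zero[OF assms(8)]) (simp add: bit_sign_def)
  have "0 < 2 * k"
    using k by simp
  \<comment> \<open>\<open>root\<close> of positive index is strictly increasing on all reals,
    negative ones included, so comparing the roots is comparing the radicands.\<close>
  then show "family_bound G L \<pi> k < root (2 * k) (real (n * tree_walk_count d (2 * k))) \<longleftrightarrow>
      (\<Sum>z \<in> cycle_span G L - {0}. bit_sign (\<pi> z) * ?N z)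
        < - (?N 0 - real (n * tree_walk_count d (2 * k)))"
    unfolding family_bound_def split by (subst real_root_less_iff) auto
qed

end
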